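(* Let $X,Y$ be real Hilbert spaces, $C\in\mathcal L(X,Y)$, and let $(A(t))_{t\ge0}$ be a family of operators on $X$ with common dense domain $D$ satisfying the standing assumptions of the context, generating the evolution system $(\mathbb T(t,s))_{0\le s\le t}$. Let $r>0$ and let $(\mathbb S(t,s))_{0\le s\le t}$ be the evolution system generated by $(A(t)-rC^*C)_{t\ge0}$. Suppose that there exists $\tau>0$ such that $t\mapsto A(t)$ is $\tau$-periodic, and let $\mathcal O_\tau$ be the observable subspace at time $\tau$ of the pair $(\mathbb T,C)$. (i) Suppose that $((A(t))_{t\ge0},C)$ is $\mu$-weakly detectable for some $\mu\ge0$ and that $r>\mu$. Assume that $\mathbb S(\tau,0)$ is normal and bounded from below. If $\mathcal O_\tau=X$, then the Luenberger observer is a strong asymptotic observer, i.e. $\mathbb S(t,0)\varepsilon_0\to0$ in norm as $t\to+\infty$ for all $\varepsilon_0\in X$. (ii) Suppose that $A(t)$ is skew-adjoint for all $t\ge0$ and that $\mathbb S(\tau,0)$ is normal. If $\mathbb T(t,0)\mathcal O_\tau\subset\mathcal O_\tau$ and $\mathbb T(t,0)\mathcal O_\tau^\perp\subset\mathcal O_\tau^\perp$ for all $t\in[0,\tau]$, then (for any such $r>0$) the Luenberger observer is a strong asymptotic $\mathcal O_\tau$-observer, i.e. $\Pi_{\mathcal O_\tau}\mathbb S(t,0)\varepsilon_0\to0$ in norm as $t\to+\infty$ for all $\varepsilon_0\in X$, where $\Pi_{\mathcal O_\tau}$ is the orthogonal projection onto $\mathcal O_\tau$.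
   Context: $\mathcal L(X,Y)$ denotes bounded linear operators, $\mathcal L(X)=\mathcal L(X,X)$; $C^*$ is the adjoint of $C$. An operator $L\in\mathcal L(X)$ is normal if $L^*L=LL^*$, and bounded from below if there is $\alpha>0$ with $\|Lx\|\ge\alpha\|x\|$ for all $x\in X$. Standing assumptions: $D\subset X$ is a dense subspace; for every $t\ge0$, $A(t):D\to X$ generates a strongly continuous semigroup on $X$; the family is stable (in Pazy's sense): there are $M\ge1$, $\omega\in\mathbb R$ such that $(\omega,\infty)\subset\rho(A(t))$ for all $t$ and $\|\prod_{j=1}^k (\lambda-A(t_j))^{-1}\|\le M(\lambda-\omega)^{-k}$ for all $\lambda>\omega$ and all finite sequences $0\le t_1\le\dots\le t_k$ (time-ordered product); for every $x\in D$, $t\mapsto A(t)x$ is continuously differentiable in $X$. An evolution system $(U(t,s))_{0\le s\le t}$ on $X$ is a family in $\mathcal L(X)$ with $U(s,s)=\mathrm{Id}$, $U(t,\sigma)U(\sigma,s)=U(t,s)$ for $s\le \sigma\le t$, and $(t,s)\mapsto U(t,s)x$ continuous for every $x\in X$. Under the standing assumptions $(A(t))$ generates a unique evolution system $\mathbb T$: for $x\in D$, $U(t,s)x\in D$, $\partial_tU(t,s)x=A(t)U(t,s)x$ and $\partial_sU(t,s)x=-U(t,s)A(s)x$; and $\|\mathbb T(t,s)\|\le Me^{\omega(t-s)}$ for some constants $M,\omega>0$. Likewise $(A(t)-rC^*C)_{t\ge0}$ generates a unique evolution system $\mathbb S$ (depending on $r$). System: $\dot z=A(t)z$, $z(0)=z_0$,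 $y=Cz$. Luenberger observer: $\dot{\hat z}=A(t)\hat z-rC^*(C\hat z-y)$, $\hat z(0)=\hat z_0$. The error $\varepsilon=\hat z-z$ is $\varepsilon(t)=\mathbb S(t,0)\varepsilon_0$, $\varepsilon_0=\hat z_0-z_0$. $((A(t))_{t\ge0},C)$ is $\mu$-weakly detectable if $\langle A(t)x,x\rangle_X\le\mu\|Cx\|_Y^2$ for all $t\ge0$ and $x\in D$. $W(0,\tau)z_0=\int_0^\tau\mathbb T(t,0)^*C^*C\,\mathbb T(t,0)z_0\,dt$, and the observable subspace at time $\tau$ of $(\mathbb T,C)$ is $\mathcal O_\tau=(\ker W(0,\tau))^\perp$. *)

theory Defs
  imports "HOL-Analysis.Analysis"
begin

text \<open>
  Real Hilbert spaces are types of sort \<open>{real_inner, complete_space}\<close>.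
  An unbounded operator is a set \<open>D\<close> (its domain) together with a total function \<open>A\<close>
  of which only the values on \<open>D\<close> matter.
\<close>

subsection \<open>Semigroups and generators\<close>

definition C0_semigroup :: "(real \<Rightarrow> 'a::real_normed_vector \<Rightarrow>\<^sub>L 'a) \<Rightarrow> bool" where
  "C0_semigroup G \<longleftrightarrow>
     G 0 = id_blinfun \<and>
     (\<forall>s\<ge>0. \<forall>t\<ge>0. G (s + t) = G s o\<^sub>L G t) \<and>
     (\<forall>x. ((\<lambda>t. G t x) \<longlongrightarrow> x) (at_right 0))"

text \<open>The domain is exactly \<open>D\<close>: every \<open>x\<close> at which the difference quotient converges lies in \<open>D\<close>.\<close>

definition generates_C0_semigroup :: "'a::real_normed_vector set \<Rightarrow> ('a \<Rightarrow> 'a) \<Rightarrow> bool" where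
  "generates_C0_semigroup D A \<longleftrightarrow>
     (\<exists>G. C0_semigroup G \<and>
       D = {x. \<exists>y. ((\<lambda>h. (G h x - x) /\<^sub>R h) \<longlongrightarrow> y) (at_right 0)} \<and>
       (\<forall>x\<in>D. ((\<lambda>h. (G h x - x) /\<^sub>R h) \<longlongrightarrow> A x) (at_right 0)))"

subsection \<open>Resolvents and stable families\<close>

definition resolvent_set :: "'a::real_normed_vector set \<Rightarrow> ('a \<Rightarrow> 'a) \<Rightarrow> real set" where
  "resolvent_set D A =
     {l. bij_betw (\<lambda>x. l *\<^sub>R x - A x) D UNIV \<and>
         bounded_linear (inv_into D (\<lambda>x. l *\<^sub>R x - A x))}"

definition resolvent :: "'a::real_normed_vector set \<Rightarrow> ('a \<Rightarrow> 'a) \<Rightarrow> real \<Rightarrow> 'a \<Rightarrow>\<^sub>L 'a" where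
  "resolvent D A l = Blinfun (inv_into D (\<lambda>x. l *\<^sub>R x - A x))"

text \<open>
  Stability in the sense of Pazy. For \<open>ts = [t\<^sub>1, \<dots>, t\<^sub>k]\<close> the \<open>fold\<close> below is the time-ordered
  product in which the resolvent at \<open>t\<^sub>k\<close>, the latest time, is the leftmost factor.
\<close>

definition stable_family :: "'a::real_normed_vector set \<Rightarrow> (real \<Rightarrow> 'a \<Rightarrow> 'a) \<Rightarrow> bool" where
  "stable_family D A \<longleftrightarrow>
     (\<exists>M\<ge>1. \<exists>\<omega>.
       (\<forall>t\<ge>0. {\<omega><..} \<subseteq> resolvent_set D (A t)) \<and>
       (\<forall>l>\<omega>. \<forall>ts. sorted ts \<and> (\<forall>t\<in>set ts. 0 \<le> t) \<longrightarrow>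
          norm (fold (\<lambda>t R. resolvent D (A t) l o\<^sub>L R) ts id_blinfun)
            \<le> M / (l - \<omega>) ^ length ts))"

definition standing_assumptions :: "'a::real_normed_vector set \<Rightarrow> (real \<Rightarrow> 'a \<Rightarrow> 'a) \<Rightarrow> bool" where
  "standing_assumptions D A \<longleftrightarrow>
     subspace D \<and> closure D = UNIV \<and>
     (\<forall>t\<ge>0. generates_C0_semigroup D (A t)) \<and>
     stable_family D A \<and>
     (\<forall>x\<in>D. \<exists>A'. (\<forall>t\<ge>0. ((\<lambda>t. A t x) has_vector_derivative A' t) (at t within {0..})) \<and>
                 continuous_on {0..} A')"

subsection \<open>Evolution systems\<close>

text \<open>Only the values \<open>U t s\<close> with \<open>0 \<le> s \<le> t\<close> are meaningful.\<close>

definition evolution_system :: "(real \<Rightarrow> real \<Rightarrow> 'a::real_normed_vector \<Rightarrow>\<^sub>L 'a) \<Rightarrow> bool" where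
  "evolution_system U \<longleftrightarrow>
     (\<forall>s\<ge>0. U s s = id_blinfun) \<and>
     (\<forall>s \<sigma> t. 0 \<le> s \<and> s \<le> \<sigma> \<and> \<sigma> \<le> t \<longrightarrow> U t \<sigma> o\<^sub>L U \<sigma> s = U t s) \<and>
     (\<forall>x. continuous_on {(t, s). 0 \<le> s \<and> s \<le> t} (\<lambda>(t, s). U t s x))"

text \<open>
  For \<open>D\<close> dense these conditions determine \<open>U\<close> on \<open>{(t, s). 0 \<le> s \<le> t}\<close>, since the two
  derivative formulas make \<open>\<sigma> \<mapsto> V t \<sigma> (U \<sigma> s x)\<close> constant for any two such systems
  \<open>U\<close>, \<open>V\<close> and \<open>x \<in> D\<close>; so \<open>U\<close> is \<^emph>\<open>the\<close> evolution system generated by the family.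
\<close>

definition generates_evolution_system ::
    "'a::real_normed_vector set \<Rightarrow> (real \<Rightarrow> 'a \<Rightarrow> 'a) \<Rightarrow> (real \<Rightarrow> real \<Rightarrow> 'a \<Rightarrow>\<^sub>L 'a) \<Rightarrow> bool" where
  "generates_evolution_system D A U \<longleftrightarrow>
     evolution_system U \<and>
     (\<forall>x\<in>D. \<forall>s t. 0 \<le> s \<and> s \<le> t \<longrightarrow>
        U t s x \<in> D \<and>
        ((\<lambda>t. U t s x) has_vector_derivative A t (U t s x)) (at t within {s..}) \<and>
        ((\<lambda>s. U t s x) has_vector_derivative - U t s (A s x)) (at s within {0..t}))"

subsection \<open>Properties of operators\<close>

definition normal_operator :: "('a::real_inner \<Rightarrow>\<^sub>L 'a) \<Rightarrow> bool" where
  "normal_operator L \<longleftrightarrow>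
     adjoint (blinfun_apply L) \<circ> blinfun_apply L = blinfun_apply L \<circ> adjoint (blinfun_apply L)"

definition bounded_from_below :: "('a::real_normed_vector \<Rightarrow>\<^sub>L 'b::real_normed_vector) \<Rightarrow> bool" where
  "bounded_from_below L \<longleftrightarrow> (\<exists>\<alpha>>0. \<forall>x. \<alpha> * norm x \<le> norm (L x))"

text \<open>Domain and values of the Hilbert space adjoint of a densely defined operator.\<close>

definition adjoint_domain :: "'a::real_inner set \<Rightarrow> ('a \<Rightarrow> 'a) \<Rightarrow> 'a set" where
  "adjoint_domain D A = {y. \<exists>z. \<forall>x\<in>D. A x \<bullet> y = x \<bullet> z}"

definition adjoint_on :: "'a::real_inner set \<Rightarrow> ('a \<Rightarrow> 'a) \<Rightarrow> 'a \<Rightarrow> 'a" where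
  "adjoint_on D A y = (THE z. \<forall>x\<in>D. A x \<bullet> y = x \<bullet> z)"

definition skew_adjoint :: "'a::real_inner set \<Rightarrow> ('a \<Rightarrow> 'a) \<Rightarrow> bool" where
  "skew_adjoint D A \<longleftrightarrow> adjoint_domain D A = D \<and> (\<forall>y\<in>D. adjoint_on D A y = - A y)"

definition orth_proj :: "'a::real_inner set \<Rightarrow> 'a \<Rightarrow> 'a" where
  "orth_proj S x = (THE p. p \<in> S \<and> x - p \<in> S\<^sup>\<bottom>)"

subsection \<open>Observability and detectability\<close>

definition weakly_detectable ::
    "'a::real_inner set \<Rightarrow> (real \<Rightarrow> 'a \<Rightarrow> 'a) \<Rightarrow> ('a \<Rightarrow>\<^sub>L 'b::real_inner) \<Rightarrow> real \<Rightarrow> bool" where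
  "weakly_detectable D A C \<mu> \<longleftrightarrow> (\<forall>t\<ge>0. \<forall>x\<in>D. A t x \<bullet> x \<le> \<mu> * (norm (C x))\<^sup>2)"

text \<open>
  The integral is the Henstock-Kurzweil integral, as the library's Bochner integral needs a
  second countable codomain. The integrand is bounded and weakly continuous, hence Bochner
  integrable on \<open>{0..\<tau>}\<close> by Pettis' theorem, and the two integrals agree.
\<close>

definition observability_gramian ::
    "(real \<Rightarrow> real \<Rightarrow> 'a::real_inner \<Rightarrow>\<^sub>L 'a) \<Rightarrow> ('a \<Rightarrow>\<^sub>L 'b::real_inner) \<Rightarrow> real \<Rightarrow> 'a \<Rightarrow> 'a" where
  "observability_gramian U C \<tau> z =
     integral {0..\<tau>}
       (\<lambda>t. adjoint (blinfun_apply (U t 0)) (adjoint (blinfun_apply C) (C (U t 0 z))))"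

definition observable_subspace ::
    "(real \<Rightarrow> real \<Rightarrow> 'a::real_inner \<Rightarrow>\<^sub>L 'a) \<Rightarrow> ('a \<Rightarrow>\<^sub>L 'b::real_inner) \<Rightarrow> real \<Rightarrow> 'a set" where
  "observable_subspace U C \<tau> = {z. observability_gramian U C \<tau> z = 0}\<^sup>\<bottom>"

text \<open>The family \<open>A t - r C\<^sup>* C\<close>, which governs the error of the Luenberger observer with gain \<open>r\<close>.\<close>

definition observer_family ::
    "(real \<Rightarrow> 'a::real_inner \<Rightarrow> 'a) \<Rightarrow> ('a \<Rightarrow>\<^sub>L 'b::real_inner) \<Rightarrow> real \<Rightarrow> real \<Rightarrow> 'a \<Rightarrow> 'a" where
  "observer_family A C r t x = A t x - r *\<^sub>R adjoint (blinfun_apply C) (C x)"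

text \<open>
  \<open>S\<close> is the evolution system of the observer family: the difference between the observer and
  the observed state at time \<open>t\<close> is \<open>S t 0 \<epsilon>\<^sub>0\<close>, with \<open>\<epsilon>\<^sub>0\<close> the initial difference.
\<close>

definition strong_asymptotic_observer ::
    "(real \<Rightarrow> real \<Rightarrow> 'a::real_normed_vector \<Rightarrow>\<^sub>L 'a) \<Rightarrow> bool" where
  "strong_asymptotic_observer S \<longleftrightarrow> (\<forall>\<epsilon>\<^sub>0. ((\<lambda>t. S t 0 \<epsilon>\<^sub>0) \<longlongrightarrow> 0) at_top)"

definition strong_asymptotic_observer_on ::
    "'a::real_inner set \<Rightarrow> (real \<Rightarrow> real \<Rightarrow> 'a \<Rightarrow>\<^sub>L 'a) \<Rightarrow> bool" where
  "strong_asymptotic_observer_on V S \<longleftrightarrow>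
     (\<forall>\<epsilon>\<^sub>0. ((\<lambda>t. orth_proj V (S t 0 \<epsilon>\<^sub>0)) \<longlongrightarrow> 0) at_top)"

end

theory Submission
  imports Defs
begin

text \<open>
  Write \<open>L = S(\<tau>, 0)\<close>. Since \<open>d/dt \<parallel>S(t,0) x\<parallel>\<^sup>2 \<le> - 2 (r - \<mu>) \<parallel>C S(t,0) x\<parallel>\<^sup>2\<close> for \<open>x \<in> D\<close>, the error
  never grows, and by periodicity the error at time \<open>n \<tau> + s\<close> is \<open>S(s, 0) L^n x\<close>. Everything is
  thus decided by the powers of the contraction \<open>L\<close>. In part (ii) skew-adjointness gives weak
  detectability with \<open>\<mu> = 0\<close>, so both parts share this setting, the locale \<open>observer_error\<close>.

  Because \<open>L\<close> is normal, \<open>(L\<^sup>* L)^n x\<close> converges to some \<open>p\<close> such that \<open>L^n (x - p)\<close> tends to \<open>0\<close>,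
  while \<open>L\<close> preserves the norm of every \<open>L^n p\<close> (\<open>normal_contraction_splitting\<close>). A state \<open>q\<close> with
  \<open>\<parallel>L q\<parallel> = \<parallel>q\<parallel>\<close> dissipates nothing over one period, so \<open>C S(t,0) q = 0\<close> there
  (\<open>output_zero_if_norm_preserved\<close>). Without output the observer correction vanishes, hence \<open>S\<close> and
  \<open>T\<close> agree along \<open>q\<close> (\<open>free_evolution_if_output_zero\<close>), the output of the system itself vanishes,
  and \<open>q\<close> lies in the kernel of the Gramian.

  In part (i) that kernel is trivial, so \<open>p = 0\<close>. In part (ii) all \<open>L^n p\<close> lie in the orthogonal
  complement of the observable subspace, \<open>S(s, 0)\<close> acts on them as \<open>T(s, 0)\<close>, which by assumption leaves
  the complement invariant; the projection therefore only sees the part \<open>x - p\<close>, which decays.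

  The estimates hold first for \<open>x \<in> D\<close>, where the trajectories are differentiable, and pass to all
  \<open>x\<close> by density. Since \<^const>\<open>adjoint\<close> is a choice of function and \<^const>\<open>orth_proj\<close> a definite
  description, both mean what they should only through the projection theorem and the Riesz
  representation, where completeness enters.
\<close>

section \<open>Projections and adjoints in Hilbert spaces\<close>

text \<open>
  This is the form in which an inner product identity yields convergence, both for minimising
  sequences of a distance and for the powers of a positive contraction.
\<close>

lemma Cauchy_if_norm_diff_sq_le:
  fixes X :: "nat \<Rightarrow> 'a::real_normed_vector"
  assumes le: "\<And>m n. (norm (X m - X n))\<^sup>2 \<le> e m + e n" and e: "e \<longlonglongrightarrow> 0"
  shows "Cauchy X"
proof (rule CauchyI)
  fix d :: real
  assume "0 < d"
  then have "0 < d\<^sup>2 / 2"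
    by simp
  then obtain N where N: "\<And>n. n \<ge> N \<Longrightarrow> e n < d\<^sup>2 / 2"
    using order_tendstoD(2)[OF e] unfolding eventually_sequentially by blast
  have "norm (X m - X n) < d" if "m \<ge> N" "n \<ge> N" for m n
  proof (rule power2_less_imp_less)
    show "(norm (X m - X n))\<^sup>2 < d\<^sup>2"
      using le[of m n] N[OF that(1)] N[OF that(2)] by linarith
  qed (use \<open>0 < d\<close> in simp)
  then show "\<exists>M. \<forall>m\<ge>M. \<forall>n\<ge>M. norm (X m - X n) < d"
    by blast
qed

text \<open>
  A minimising sequence for the distance from \<open>x\<close> to \<open>V\<close> is Cauchy by the parallelogram law,
  and the difference between \<open>x\<close> and its limit is orthogonal to \<open>V\<close>, since a shift along any
  \<open>v \<in> V\<close> cannot shorten it.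
\<close>

lemma orthogonal_decomposition_exists:
  fixes V :: "'a::{real_inner,complete_space} set"
  assumes V: "subspace V" and cl: "closed V"
  shows "\<exists>p\<in>V. x - p \<in> V\<^sup>\<bottom>"
proof -
  define F where "F = (\<lambda>v. (norm (x - v))\<^sup>2) ` V"
  define d where "d = Inf F"
  have ne: "F \<noteq> {}"
    using subspace_0[OF V] by (auto simp: F_def)
  have bdd: "bdd_below F"
    by (rule bdd_belowI[of _ 0]) (auto simp: F_def)
  have d_le: "d \<le> (norm (x - v))\<^sup>2" if "v \<in> V" for v
    unfolding d_def by (rule cInf_lower[OF _ bdd]) (use that in \<open>auto simp: F_def\<close>)
  have "\<exists>v\<in>V. (norm (x - v))\<^sup>2 < d + inverse (real (Suc n))" for n
    using cInf_lessD[OF ne, of "d + inverse (real (Suc n))"] by (auto simp: d_def F_def)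
  then obtain v where vV: "\<And>n. v n \<in> V"
    and v_less: "\<And>n. (norm (x - v n))\<^sup>2 < d + inverse (real (Suc n))"
    by metis
  have e0: "(\<lambda>n. 2 * inverse (real (Suc n))) \<longlonglongrightarrow> 0"
    using tendsto_mult_right_zero[OF LIMSEQ_inverse_real_of_nat, of 2] by simp
  have "Cauchy v"
  proof (rule Cauchy_if_norm_diff_sq_le[OF _ e0])
    fix m n
    have "(1/2) *\<^sub>R (v m + v n) \<in> V"
      using V vV by (simp add: subspace_add subspace_scale)
    from d_le[OF this] have "d \<le> (norm (x - (1/2) *\<^sub>R (v m + v n)))\<^sup>2" .
    moreover have "(norm (v m - v n))\<^sup>2 = 2 * (norm (x - v m))\<^sup>2 + 2 * (norm (x - v n))\<^sup>2
        - 4 * (norm (x - (1/2) *\<^sub>R (v m + v n)))\<^sup>2"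
      by (simp add: power2_norm_eq_inner algebra_simps inner_commute)
    ultimately show "(norm (v m - v n))\<^sup>2
        \<le> 2 * inverse (real (Suc m)) + 2 * inverse (real (Suc n))"
      using v_less[of m] v_less[of n] by linarith
  qed
  then obtain p where p: "v \<longlonglongrightarrow> p"
    using Cauchy_convergent convergent_def by blast
  have pV: "p \<in> V"
    using closed_sequentially[OF cl vV p] .
  have "(\<lambda>n. (norm (x - v n))\<^sup>2) \<longlonglongrightarrow> (norm (x - p))\<^sup>2"
    by (intro tendsto_intros p)
  moreover have "(\<lambda>n. d + inverse (real (Suc n))) \<longlonglongrightarrow> d + 0"
    by (intro tendsto_intros LIMSEQ_inverse_real_of_nat)
  ultimately have "(norm (x - p))\<^sup>2 \<le> d + 0"
    by (rule LIMSEQ_le) (use v_less in \<open>auto intro: less_imp_le\<close>)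
  then have p_min: "(norm (x - p))\<^sup>2 \<le> d"
    by simp
  have "(x - p) \<bullet> w = 0" if w: "w \<in> V" for w
  proof (cases "w = 0")
    case False
    define t where "t = ((x - p) \<bullet> w) / (w \<bullet> w)"
    have "p + t *\<^sub>R w \<in> V"
      using V pV w by (simp add: subspace_add subspace_scale)
    from d_le[OF this] p_min have "(norm (x - p))\<^sup>2 \<le> (norm ((x - p) - t *\<^sub>R w))\<^sup>2"
      by (metis diff_diff_add order_trans)
    also have "\<dots> = (norm (x - p))\<^sup>2 - 2 * t * ((x - p) \<bullet> w) + t\<^sup>2 * (w \<bullet> w)"
      unfolding power2_norm_eq_inner
      by (simp only: inner_diff_left[of "x - p"] inner_diff_right[of _ "x - p"] inner_scaleR_left
          inner_scaleR_right inner_commute[of w "x - p"])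
        (simp add: power2_eq_square right_diff_distrib)
    also have "\<dots> = (norm (x - p))\<^sup>2 - ((x - p) \<bullet> w)\<^sup>2 / (w \<bullet> w)"
      using False by (simp add: t_def field_simps power2_eq_square)
    finally have "((x - p) \<bullet> w)\<^sup>2 / (w \<bullet> w) \<le> 0"
      by simp
    then show ?thesis
      using False pos_divide_le_eq[of "w \<bullet> w" "((x - p) \<bullet> w)\<^sup>2" 0] by simp
  qed simp
  then show ?thesis
    using pV by (auto simp: orthogonal_comp_def orthogonal_def inner_commute[of _ "x - _"])
qed

text \<open>
  Riesz representation: a functional is the inner product with a suitable multiple of any vector
  outside and orthogonal to its kernel.
\<close>

lemma riesz_representation:
  fixes f :: "'a::{real_inner,complete_space} \<Rightarrow> real"
  assumes f: "bounded_linear f"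
  shows "\<exists>z. \<forall>x. f x = x \<bullet> z"
proof (cases "\<forall>x. f x = 0")
  case True
  then show ?thesis
    by (intro exI[of _ 0]) simp
next
  case False
  interpret f: bounded_linear f by (rule f)
  obtain u where u: "f u \<noteq> 0"
    using False by blast
  define V where "V = f -` {0}"
  have "subspace V"
    by (auto simp: V_def subspace_def f.add f.scaleR f.zero)
  moreover have "closed V"
    unfolding V_def by (intro continuous_closed_vimage) (auto intro: f.isCont)
  ultimately obtain p where pV: "p \<in> V" and pO: "u - p \<in> V\<^sup>\<bottom>"
    using orthogonal_decomposition_exists by blast
  define w where "w = u - p"
  have fw: "f w \<noteq> 0"
    using u pV by (simp add: w_def V_def f.diff)
  have w0: "w \<noteq> 0"
    using fw f.zero by auto
  have orth: "y \<bullet> w = 0" if "f y = 0" for y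
    using pO that by (auto simp: w_def orthogonal_comp_def orthogonal_def V_def)
  have "f x = x \<bullet> ((f w / (w \<bullet> w)) *\<^sub>R w)" for x
  proof -
    have "(x - (f x / f w) *\<^sub>R w) \<bullet> w = 0"
      by (rule orth) (use fw in \<open>simp add: f.diff f.scaleR\<close>)
    then show ?thesis
      using fw w0 by (simp add: inner_diff_left field_simps)
  qed
  then show ?thesis
    by blast
qed

lemma inner_adjoint_blinfun:
  fixes L :: "'a::{real_inner,complete_space} \<Rightarrow>\<^sub>L 'b::real_inner"
  shows "L x \<bullet> y = x \<bullet> adjoint (blinfun_apply L) y"
proof -
  have "\<exists>z. \<forall>x. L x \<bullet> y = x \<bullet> z" for y
    by (rule riesz_representation)
      (rule bounded_linear_compose[OF bounded_linear_inner_left blinfun.bounded_linear_right])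
  then obtain g where "\<forall>x y. L x \<bullet> y = x \<bullet> g y"
    by metis
  then show ?thesis
    using adjoint_unique by metis
qed

lemma adjoint_blinfun_zero:
  fixes L :: "'a::{real_inner,complete_space} \<Rightarrow>\<^sub>L 'b::real_inner"
  shows "adjoint (blinfun_apply L) 0 = 0"
  using inner_adjoint_blinfun[of L "adjoint (blinfun_apply L) 0" 0] by simp

lemma closed_orthogonal_comp: "closed (N\<^sup>\<bottom>)"
proof -
  have "N\<^sup>\<bottom> = (\<Inter>y\<in>N. {x. y \<bullet> x = 0})"
    by (auto simp: orthogonal_comp_def orthogonal_def)
  then show ?thesis
    by (auto intro!: closed_INT closed_hyperplane)
qed

text \<open>
  Only the summand \<open>a\<close> is seen by the projection, which contracts.
\<close>

lemma norm_orth_proj_add_le: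
  fixes V :: "'a::{real_inner,complete_space} set"
  assumes V: "subspace V" and cl: "closed V" and b: "b \<in> V\<^sup>\<bottom>"
  shows "norm (orth_proj V (a + b)) \<le> norm a"
proof -
  note Vo = subspace_orthogonal_comp[of V]
  have "\<exists>!p. p \<in> V \<and> (a + b) - p \<in> V\<^sup>\<bottom>"
  proof (rule ex_ex1I)
    show "\<exists>p. p \<in> V \<and> (a + b) - p \<in> V\<^sup>\<bottom>"
      using orthogonal_decomposition_exists[OF V cl] by blast
  next
    fix p q
    assume p: "p \<in> V \<and> (a + b) - p \<in> V\<^sup>\<bottom>" and q: "q \<in> V \<and> (a + b) - q \<in> V\<^sup>\<bottom>"
    have "p - q \<in> V"
      using p q V by (simp add: subspace_diff)
    moreover have "((a + b) - q) - ((a + b) - p) \<in> V\<^sup>\<bottom>"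
      using p q Vo by (blast intro: subspace_diff)
    ultimately have "(p - q) \<bullet> (p - q) = 0"
      by (simp add: orthogonal_comp_def orthogonal_def)
    then show "p = q"
      by simp
  qed
  from theI'[OF this] have pV: "orth_proj V (a + b) \<in> V"
    and "(a + b) - orth_proj V (a + b) \<in> V\<^sup>\<bottom>"
    unfolding orth_proj_def by auto
  then have "((a + b) - orth_proj V (a + b)) - b \<in> V\<^sup>\<bottom>"
    using Vo b by (blast intro: subspace_diff)
  then have "orthogonal (orth_proj V (a + b)) (a - orth_proj V (a + b))"
    using pV by (auto simp: orthogonal_comp_def algebra_simps)
  then have "(norm (orth_proj V (a + b) + (a - orth_proj V (a + b))))\<^sup>2
      = (norm (orth_proj V (a + b)))\<^sup>2 + (norm (a - orth_proj V (a + b)))\<^sup>2"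
    by (rule norm_add_Pythagorean)
  then have "(norm (orth_proj V (a + b)))\<^sup>2 \<le> (norm a)\<^sup>2"
    by simp
  then show ?thesis
    by (rule power2_le_imp_le) simp
qed

section \<open>Powers of a normal contraction\<close>

text \<open>
  Let \<open>H = L\<^sup>* L\<close>. The numbers \<open>\<langle>H^n x, x\<rangle>\<close> decrease, and
  \<open>\<parallel>H^m x - H^n x\<parallel>\<^sup>2\<close> is a second difference of them, so \<open>H^n x\<close> converges to some \<open>p\<close> with
  \<open>H p = p\<close>. Normality enters twice: it gives \<open>\<parallel>L^n y\<parallel>\<^sup>2 = \<langle>H^n y, y\<rangle>\<close>, which tends to \<open>0\<close> for
  \<open>y = x - p\<close>, and it makes \<open>L\<close> preserve the fixed points of \<open>H\<close>, on which \<open>L\<close> is isometric.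
\<close>

lemma normal_contraction_splitting:
  fixes L :: "'a::{real_inner,complete_space} \<Rightarrow>\<^sub>L 'a"
  assumes normal: "normal_operator L" and contr: "\<And>x. norm (L x) \<le> norm x"
  shows "\<exists>p. (\<forall>n. norm (L ((blinfun_apply L ^^ n) p)) = norm ((blinfun_apply L ^^ n) p))
           \<and> (\<lambda>n. (blinfun_apply L ^^ n) (x - p)) \<longlonglongrightarrow> 0"
proof -
  define L' where "L' = adjoint (blinfun_apply L)"
  define H where "H = (\<lambda>x. L' (L x))"
  have adj: "L x \<bullet> y = x \<bullet> L' y" for x y
    unfolding L'_def by (rule inner_adjoint_blinfun)
  have comm: "H z = L (L' z)" for z
    using normal unfolding normal_operator_def H_def L'_def by (metis comp_apply)
  have HL: "H (L z) = L (H z)" for z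
    using comm[of "L z"] by (simp add: H_def)
  have H_sa: "H z \<bullet> w = z \<bullet> H w" for z w
    by (metis H_def adj inner_commute)
  have HnL: "(H ^^ n) (L z) = L ((H ^^ n) z)" for n z
    by (induction n) (simp_all add: HL)
  have LnH: "H ((blinfun_apply L ^^ n) z) = (blinfun_apply L ^^ n) (H z)" for n z
    by (induction n) (simp_all add: HL)
  have LH: "(blinfun_apply L ^^ n) z \<bullet> (blinfun_apply L ^^ n) w = (H ^^ n) z \<bullet> w" for n z w
  proof (induction n arbitrary: z w)
    case (Suc n)
    have "(blinfun_apply L ^^ Suc n) z \<bullet> (blinfun_apply L ^^ Suc n) w = (H ^^ n) (L z) \<bullet> L w"
      using Suc.IH by (simp add: funpow_Suc_right del: funpow.simps)
    also have "\<dots> = L w \<bullet> L ((H ^^ n) z)"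
      by (simp add: HnL inner_commute)
    also have "\<dots> = (H ^^ Suc n) z \<bullet> w"
      by (simp add: adj H_def inner_commute)
    finally show ?case .
  qed simp
  have Hmn: "(H ^^ m) z \<bullet> (H ^^ n) w = (H ^^ (m + n)) z \<bullet> w" for m n z w
  proof (induction n arbitrary: w)
    case (Suc n)
    have "(H ^^ m) z \<bullet> (H ^^ Suc n) w = (H ^^ m) z \<bullet> (H ^^ n) (H w)"
      by (simp add: funpow_Suc_right del: funpow.simps)
    also have "\<dots> = H ((H ^^ (m + n)) z) \<bullet> w"
      using Suc.IH H_sa by simp
    finally show ?case
      by simp
  qed simp
  define a where "a n = (norm ((blinfun_apply L ^^ n) x))\<^sup>2" for n
  have a_eq: "a n = (H ^^ n) x \<bullet> x" for n
    by (simp add: a_def power2_norm_eq_inner LH)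
  have "decseq a"
    unfolding decseq_Suc_iff a_def by (auto intro: power_mono contr)
  moreover have "\<forall>n. 0 \<le> a n"
    by (simp add: a_def)
  ultimately obtain l where al: "a \<longlonglongrightarrow> l" and la: "\<forall>n. l \<le> a n"
    by (rule decseq_convergent)
  have e0: "(\<lambda>n. a (n + n) - l) \<longlonglongrightarrow> 0"
  proof -
    have "strict_mono (\<lambda>n::nat. n + n)"
      by (rule strict_monoI) simp
    from LIMSEQ_subseq_LIMSEQ[OF al this] have "(\<lambda>n. a (n + n)) \<longlonglongrightarrow> l"
      by (simp add: o_def)
    from tendsto_diff[OF this tendsto_const[of l]] show ?thesis
      by simp
  qed
  have "Cauchy (\<lambda>n. (H ^^ n) x)"
  proof (rule Cauchy_if_norm_diff_sq_le[OF _ e0])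
    fix m n
    have "(norm ((H ^^ m) x - (H ^^ n) x))\<^sup>2 = a (m + m) - 2 * a (m + n) + a (n + n)"
      by (simp add: power2_norm_eq_inner inner_diff_left inner_diff_right Hmn a_eq add.commute)
    then show "(norm ((H ^^ m) x - (H ^^ n) x))\<^sup>2 \<le> (a (m + m) - l) + (a (n + n) - l)"
      using la[rule_format, of "m + n"] by linarith
  qed
  then obtain p where p: "(\<lambda>n. (H ^^ n) x) \<longlonglongrightarrow> p"
    using Cauchy_convergent convergent_def by blast
  have Hp: "H p = p"
  proof -
    have "w \<bullet> H p = w \<bullet> p" for w
    proof (rule LIMSEQ_unique)
      have "(\<lambda>n. H w \<bullet> (H ^^ n) x) \<longlonglongrightarrow> H w \<bullet> p"
        by (intro tendsto_intros p)
      then show "(\<lambda>n. w \<bullet> (H ^^ Suc n) x) \<longlonglongrightarrow> w \<bullet> H p"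
        by (simp add: H_sa)
      show "(\<lambda>n. w \<bullet> (H ^^ Suc n) x) \<longlonglongrightarrow> w \<bullet> p"
        by (intro tendsto_intros LIMSEQ_Suc p)
    qed
    then show ?thesis
      by (metis vector_eq_rdot inner_commute)
  qed
  have H_diff: "H (z - w) = H z - H w" for z w
  proof -
    have "u \<bullet> H (z - w) = u \<bullet> (H z - H w)" for u
      by (metis H_sa inner_diff_right)
    then show ?thesis
      by (metis vector_eq_rdot inner_commute)
  qed
  have Hn_diff: "(H ^^ n) (x - p) = (H ^^ n) x - p" for n
    by (induction n) (simp_all add: H_diff Hp)
  have "(\<lambda>n. (norm ((blinfun_apply L ^^ n) (x - p)))\<^sup>2) \<longlonglongrightarrow> (p - p) \<bullet> (x - p)"
    unfolding power2_norm_eq_inner LH Hn_diff by (intro tendsto_intros p)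
  then have "(\<lambda>n. (blinfun_apply L ^^ n) (x - p)) \<longlonglongrightarrow> 0"
    by (simp add: tendsto_norm_zero_iff)
  moreover have "norm (L ((blinfun_apply L ^^ n) p)) = norm ((blinfun_apply L ^^ n) p)" for n
  proof -
    define q where "q = (blinfun_apply L ^^ n) p"
    have "H q = q"
      by (simp add: q_def LnH Hp)
    then have "(norm (L q))\<^sup>2 = (norm q)\<^sup>2"
      by (simp add: power2_norm_eq_inner adj H_def)
    then show ?thesis
      by (simp add: q_def)
  qed
  ultimately show ?thesis
    by blast
qed

section \<open>Energy estimates for the observer error\<close>

text \<open>
  Gronwall's inequality for the energy of a differentiable curve: the energy times \<open>exp (- k t)\<close>,
  less \<open>c t\<close>, is nonincreasing. Contraction, uniqueness and comparison of evolutions reduce to it.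
\<close>

lemma norm_sq_gronwall:
  fixes v :: "real \<Rightarrow> 'a::real_inner"
  assumes deriv: "\<And>t. 0 \<le> t \<Longrightarrow> (v has_vector_derivative v' t) (at t within {0..})"
    and growth: "\<And>t. 0 \<le> t \<Longrightarrow> t \<le> b \<Longrightarrow> 2 * (v' t \<bullet> v t) \<le> k * (norm (v t))\<^sup>2 + c"
    and k: "0 \<le> k" and c: "0 \<le> c" and b: "0 \<le> b"
  shows "(norm (v b))\<^sup>2 \<le> ((norm (v 0))\<^sup>2 + c * b) * exp (k * b)"
proof -
  define f where "f t = (v t \<bullet> v t) * exp (- k * t) - c * t" for t
  define f' where "f' t = (2 * (v' t \<bullet> v t) - k * (v t \<bullet> v t)) * exp (- k * t) - c" for t
  have df: "(f has_real_derivative f' t) (at t within {0..})" if "0 \<le> t" for t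
  proof -
    have "((\<lambda>t. v t \<bullet> v t) has_real_derivative 2 * (v' t \<bullet> v t)) (at t within {0..})"
      using has_derivative_inner[OF deriv[OF that, unfolded has_vector_derivative_def]
          deriv[OF that, unfolded has_vector_derivative_def]]
      by (simp add: has_field_derivative_def inner_commute mult_ac mult_commute_abs)
    then show ?thesis
      unfolding f_def f'_def by (auto intro!: derivative_eq_intros simp: algebra_simps)
  qed
  have "f b \<le> f 0"
  proof (rule DERIV_nonpos_imp_decreasing_open[OF b])
    fix t
    assume t: "0 < t" "t < b"
    then have "(f has_real_derivative f' t) (at t)"
      using df[of t] at_within_interior[of t "{0..}"] by simp
    moreover have "f' t \<le> 0"
    proof -
      have "(2 * (v' t \<bullet> v t) - k * (v t \<bullet> v t)) * exp (- k * t) \<le> c * 1"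
        by (intro mult_mono)
          (use growth[of t] t k c in \<open>auto simp: power2_norm_eq_inner\<close>)
      then show ?thesis
        by (simp add: f'_def)
    qed
    ultimately show "\<exists>y. (f has_real_derivative y) (at t) \<and> y \<le> 0"
      by blast
  next
    show "continuous_on {0..b} f"
      by (rule continuous_on_subset[of "{0..}"])
        (use df has_field_derivative_imp_has_derivative has_derivative_continuous in
          \<open>fastforce simp: continuous_on_eq_continuous_within\<close>)+
  qed
  then have "(norm (v b))\<^sup>2 * exp (- k * b) \<le> (norm (v 0))\<^sup>2 + c * b"
    by (simp add: f_def power2_norm_eq_inner)
  then have "(norm (v b))\<^sup>2 * exp (- k * b) * exp (k * b) \<le> ((norm (v 0))\<^sup>2 + c * b) * exp (k * b)"
    by (rule mult_right_mono) simp
  then show ?thesis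
    by (simp add: mult.assoc flip: exp_add)
qed

lemma blinfun_norm_le_by_density:
  fixes F G :: "'a::real_normed_vector \<Rightarrow>\<^sub>L 'b::real_normed_vector"
  assumes dense: "closure D = UNIV" and le: "\<And>x. x \<in> D \<Longrightarrow> norm (F x) \<le> norm (G x)"
  shows "norm (F x) \<le> norm (G x)"
proof -
  obtain X where X: "\<And>n. X n \<in> D" "X \<longlonglongrightarrow> x"
    using dense closure_sequential[of x D] by auto
  show ?thesis
    by (rule LIMSEQ_le[of "\<lambda>n. norm (F (X n))" _ "\<lambda>n. norm (G (X n))"])
      (auto intro!: tendsto_intros X le)
qed

locale observer_error =
  fixes D :: "'x::{real_inner,complete_space} set"
    and A :: "real \<Rightarrow> 'x \<Rightarrow> 'x"
    and C :: "'x \<Rightarrow>\<^sub>L 'y::{real_inner,complete_space}"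
    and T S :: "real \<Rightarrow> real \<Rightarrow> 'x \<Rightarrow>\<^sub>L 'x"
    and r \<mu> \<tau> :: real
  assumes dense: "closure D = UNIV"
    and D_diff: "\<And>x y. x \<in> D \<Longrightarrow> y \<in> D \<Longrightarrow> x - y \<in> D"
    and A_diff: "\<And>t x y. 0 \<le> t \<Longrightarrow> x \<in> D \<Longrightarrow> y \<in> D \<Longrightarrow> A t (x - y) = A t x - A t y"
    and T_gen: "generates_evolution_system D A T"
    and S_gen: "generates_evolution_system D (observer_family A C r) S"
    and detectable: "weakly_detectable D A C \<mu>"
    and mu: "0 \<le> \<mu>" and gain: "\<mu> < r"
    and period: "0 < \<tau>"
    and periodic: "\<And>t x. 0 \<le> t \<Longrightarrow> x \<in> D \<Longrightarrow> A (t + \<tau>) x = A t x"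
    and normal: "normal_operator (S \<tau> 0)"
begin

lemma S_id: "0 \<le> s \<Longrightarrow> S s s x = x"
  using S_gen by (simp add: generates_evolution_system_def evolution_system_def)

lemma T_id: "0 \<le> s \<Longrightarrow> T s s x = x"
  using T_gen by (simp add: generates_evolution_system_def evolution_system_def)

lemma S_trans: "0 \<le> s \<Longrightarrow> s \<le> q \<Longrightarrow> q \<le> t \<Longrightarrow> S t q (S q s x) = S t s x"
  using S_gen
  by (metis blinfun_apply_blinfun_compose evolution_system_def generates_evolution_system_def)

lemma S_in_D: "x \<in> D \<Longrightarrow> 0 \<le> s \<Longrightarrow> s \<le> t \<Longrightarrow> S t s x \<in> D"
  using S_gen by (simp add: generates_evolution_system_def)

lemma T_in_D: "x \<in> D \<Longrightarrow> 0 \<le> s \<Longrightarrow> s \<le> t \<Longrightarrow> T t s x \<in> D"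
  using T_gen by (simp add: generates_evolution_system_def)

lemma S_deriv:
  "x \<in> D \<Longrightarrow> 0 \<le> s \<Longrightarrow> s \<le> t \<Longrightarrow>
    ((\<lambda>t. S t s x) has_vector_derivative observer_family A C r t (S t s x)) (at t within {s..})"
  using S_gen by (simp add: generates_evolution_system_def)

lemma T_deriv:
  "x \<in> D \<Longrightarrow> 0 \<le> s \<Longrightarrow> s \<le> t \<Longrightarrow>
    ((\<lambda>t. T t s x) has_vector_derivative A t (T t s x)) (at t within {s..})"
  using T_gen by (simp add: generates_evolution_system_def)

lemma continuous_on_S: "continuous_on {0..b} (\<lambda>t. S t 0 x)"
proof -
  have "continuous_on {(t, s). 0 \<le> s \<and> s \<le> t} (\<lambda>(t, s). S t s x)"
    using S_gen by (simp add: generates_evolution_system_def evolution_system_def)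
  moreover have "(\<lambda>t. (t, 0)) ` {0..b} \<subseteq> {(t, s::real). 0 \<le> s \<and> s \<le> t}"
    by auto
  moreover have "continuous_on {0..b} (\<lambda>t. (t, 0::real))"
    by (intro continuous_intros)
  ultimately show ?thesis
    using continuous_on_compose2[of "{(t, s). 0 \<le> s \<and> s \<le> t}" "\<lambda>(t, s). S t s x" "{0..b}" "\<lambda>t. (t, 0)"]
    by simp
qed

lemma inner_observer_family:
  "observer_family A C r t x \<bullet> y = A t x \<bullet> y - r * (C x \<bullet> C y)"
  using inner_adjoint_blinfun[of C y "C x"]
  by (simp add: observer_family_def inner_diff_left inner_diff_right inner_commute)

lemma observer_family_dissipative:
  assumes "0 \<le> t" "x \<in> D"
  shows "observer_family A C r t x \<bullet> x \<le> - ((r - \<mu>) * (norm (C x))\<^sup>2)"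
  using detectable assms
  by (auto simp: weakly_detectable_def inner_observer_family power2_norm_eq_inner algebra_simps)

text \<open>
  Stated for arbitrary solution curves in \<open>D\<close>, so that it covers differences of trajectories as well,
  and with them the uniqueness of solutions.
\<close>

lemma error_curve_contracts:
  assumes deriv: "\<And>t. 0 \<le> t \<Longrightarrow>
      (v has_vector_derivative observer_family A C r t (v t)) (at t within {0..})"
    and vD: "\<And>t. 0 \<le> t \<Longrightarrow> v t \<in> D" and b: "0 \<le> b"
  shows "norm (v b) \<le> norm (v 0)"
proof -
  have "(norm (v b))\<^sup>2 \<le> ((norm (v 0))\<^sup>2 + 0 * b) * exp (0 * b)"
  proof (rule norm_sq_gronwall[OF deriv])
    fix t :: real
    assume "0 \<le> t"
    then have "observer_family A C r t (v t) \<bullet> v t \<le> - ((r - \<mu>) * (norm (C (v t)))\<^sup>2)"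
      by (intro observer_family_dissipative vD)
    also have "\<dots> \<le> 0"
      using gain by simp
    finally show "2 * (observer_family A C r t (v t) \<bullet> v t) \<le> 0 * (norm (v t))\<^sup>2 + 0"
      by simp
  qed (use b in auto)
  then show ?thesis
    by (auto intro: power2_le_imp_le)
qed

lemma S_contraction:
  assumes "0 \<le> t"
  shows "norm (S t 0 x) \<le> norm x"
proof -
  have "norm (S t 0 x) \<le> norm (id_blinfun x)" for x
  proof (rule blinfun_norm_le_by_density[OF dense])
    fix x
    assume "x \<in> D"
    then have "norm (S t 0 x) \<le> norm (S 0 0 x)"
      using assms by (intro error_curve_contracts S_deriv S_in_D) auto
    then show "norm (S t 0 x) \<le> norm (id_blinfun x)"
      by (simp add: S_id)
  qed
  then show ?thesis
    by simp
qed

text \<open>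
  For \<open>x \<in> D\<close> both sides solve the same linear equation, as \<open>A\<close> is periodic, so their difference
  solves it too; it starts at \<open>0\<close> and stays there by \<open>error_curve_contracts\<close>.
\<close>

lemma S_periodic:
  assumes t: "0 \<le> t"
  shows "S (t + \<tau>) \<tau> x = S t 0 x"
proof -
  have "norm ((S (t + \<tau>) \<tau> - S t 0) x) \<le> norm ((0 :: 'x \<Rightarrow>\<^sub>L 'x) x)" for x
  proof (rule blinfun_norm_le_by_density[OF dense])
    fix x
    assume x: "x \<in> D"
    define v where "v t = S (t + \<tau>) \<tau> x - S t 0 x" for t
    have D1: "S (t + \<tau>) \<tau> x \<in> D" and D2: "S t 0 x \<in> D" if "0 \<le> t" for t
      using that x period by (auto intro!: S_in_D)
    have "norm (v t) \<le> norm (v 0)"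
    proof (rule error_curve_contracts[OF _ _ t])
      fix t :: real
      assume t: "0 \<le> t"
      have img: "(\<lambda>t. t + \<tau>) ` {0..} = {\<tau>..}"
        by (auto simp: image_iff intro!: bexI[of _ "_ - \<tau>"])
      have "((\<lambda>t. S t \<tau> x) has_vector_derivative observer_family A C r (t + \<tau>) (S (t + \<tau>) \<tau> x))
          (at (t + \<tau>) within (\<lambda>t. t + \<tau>) ` {0..})"
        unfolding img using S_deriv[OF x, of \<tau> "t + \<tau>"] period t by simp
      moreover have "((\<lambda>t. t + \<tau>) has_vector_derivative 1) (at t within {0..})"
        by (auto intro!: derivative_eq_intros)
      ultimately have "((\<lambda>t. S (t + \<tau>) \<tau> x) has_vector_derivative
          observer_family A C r (t + \<tau>) (S (t + \<tau>) \<tau> x)) (at t within {0..})"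
        using vector_diff_chain_within[of "\<lambda>t. t + \<tau>" 1 t "{0..}" "\<lambda>t. S t \<tau> x"]
        by (simp add: o_def)
      then have "(v has_vector_derivative observer_family A C r (t + \<tau>) (S (t + \<tau>) \<tau> x)
          - observer_family A C r t (S t 0 x)) (at t within {0..})"
        unfolding v_def using S_deriv[OF x, of 0 t] t by (intro has_vector_derivative_diff) auto
      moreover have "observer_family A C r (t + \<tau>) (S (t + \<tau>) \<tau> x)
          - observer_family A C r t (S t 0 x) = observer_family A C r t (v t)"
      proof -
        have "w \<bullet> (observer_family A C r (t + \<tau>) (S (t + \<tau>) \<tau> x)
          - observer_family A C r t (S t 0 x)) = w \<bullet> observer_family A C r t (v t)" for w
          using A_diff[OF t D1[OF t] D2[OF t]] periodic[OF t D1[OF t]]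
          by (simp add: inner_commute[of w] inner_diff_left inner_observer_family v_def
              blinfun.diff_right right_diff_distrib)
        then show ?thesis
          by (metis vector_eq_rdot inner_commute)
      qed
      ultimately show "(v has_vector_derivative observer_family A C r t (v t)) (at t within {0..})"
        by simp
      show "v t \<in> D"
        unfolding v_def by (intro D_diff D1 D2 t)
    qed
    then show "norm ((S (t + \<tau>) \<tau> - S t 0) x) \<le> norm ((0 :: 'x \<Rightarrow>\<^sub>L 'x) x)"
      using period by (simp add: v_def S_id blinfun.diff_left)
  qed
  then show ?thesis
    by (simp add: blinfun.diff_left)
qed

lemma S_iterate:
  assumes "0 \<le> s"
  shows "S (real n * \<tau> + s) 0 x = S s 0 ((blinfun_apply (S \<tau> 0) ^^ n) x)"
proof (induction n arbitrary: x)
  case (Suc n)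
  have "S (real (Suc n) * \<tau> + s) 0 x = S ((real n * \<tau> + s) + \<tau>) \<tau> (S \<tau> 0 x)"
    using S_trans[of 0 \<tau> "(real n * \<tau> + s) + \<tau>" x] assms period by (simp add: algebra_simps)
  also have "\<dots> = S (real n * \<tau> + s) 0 (S \<tau> 0 x)"
    using assms period by (intro S_periodic) simp
  finally show ?case
    using Suc.IH by (simp add: funpow_Suc_right del: funpow.simps)
qed simp

lemma S_tendsto_0_if_powers_tendsto_0:
  assumes "(\<lambda>n. (blinfun_apply (S \<tau> 0) ^^ n) x) \<longlonglongrightarrow> 0"
  shows "((\<lambda>t. S t 0 x) \<longlongrightarrow> 0) at_top"
proof (rule tendstoI)
  fix e :: real
  assume "0 < e"
  then obtain n where n: "norm ((blinfun_apply (S \<tau> 0) ^^ n) x) < e"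
    using LIMSEQ_D[OF assms] by fastforce
  have "dist (S t 0 x) 0 < e" if t: "t \<ge> real n * \<tau>" for t
  proof -
    have "norm (S t 0 x) \<le> norm ((blinfun_apply (S \<tau> 0) ^^ n) x)"
      using S_iterate[of "t - real n * \<tau>" n x] S_contraction[of "t - real n * \<tau>"] t by simp
    then show ?thesis
      using n by simp
  qed
  then show "\<forall>\<^sub>F t in at_top. dist (S t 0 x) 0 < e"
    unfolding eventually_at_top_linorder by blast
qed

section \<open>Norm-preserving states are unobservable\<close>

lemma energy_balance_on_D:
  assumes x: "x \<in> D"
  shows "2 * (r - \<mu>) * integral {0..\<tau>} (\<lambda>t. (norm (C (S t 0 x)))\<^sup>2)
    \<le> (norm x)\<^sup>2 - (norm (S \<tau> 0 x))\<^sup>2"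
proof -
  define v where "v t = S t 0 x" for t
  have "((\<lambda>t. 2 * (observer_family A C r t (v t) \<bullet> v t)) has_integral v \<tau> \<bullet> v \<tau> - v 0 \<bullet> v 0) {0..\<tau>}"
  proof (rule fundamental_theorem_of_calculus)
    fix t
    assume t: "t \<in> {0..\<tau>}"
    then have d: "(v has_vector_derivative observer_family A C r t (v t)) (at t within {0..\<tau>})"
      unfolding v_def using S_deriv[OF x, of 0 t]
      by (auto intro: has_vector_derivative_within_subset)
    show "((\<lambda>t. v t \<bullet> v t) has_vector_derivative 2 * (observer_family A C r t (v t) \<bullet> v t))
        (at t within {0..\<tau>})"
      using has_derivative_inner[OF d[unfolded has_vector_derivative_def]
          d[unfolded has_vector_derivative_def]]
      by (simp add: has_vector_derivative_def inner_commute mult_ac)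
  qed (use period in simp)
  moreover have "((\<lambda>t. (- 2 * (r - \<mu>)) * (norm (C (v t)))\<^sup>2) has_integral
      (- 2 * (r - \<mu>)) * integral {0..\<tau>} (\<lambda>t. (norm (C (v t)))\<^sup>2)) {0..\<tau>}"
    unfolding v_def
    by (intro has_integral_mult_right integrable_integral integrable_continuous_real
        continuous_intros continuous_on_S)
  ultimately have "v \<tau> \<bullet> v \<tau> - v 0 \<bullet> v 0
      \<le> (- 2 * (r - \<mu>)) * integral {0..\<tau>} (\<lambda>t. (norm (C (v t)))\<^sup>2)"
  proof (rule has_integral_le)
    fix t
    assume "t \<in> {0..\<tau>}"
    then show "2 * (observer_family A C r t (v t) \<bullet> v t) \<le> (- 2 * (r - \<mu>)) * (norm (C (v t)))\<^sup>2"
      using observer_family_dissipative[of t "v t"] S_in_D[OF x, of 0 t]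
      by (simp add: v_def algebra_simps)
  qed
  then show ?thesis
    by (simp add: v_def S_id algebra_simps flip: power2_norm_eq_inner)
qed

lemma norm_C_S_le:
  assumes "0 \<le> t"
  shows "norm (C (S t 0 x)) \<le> norm C * norm x"
  by (meson S_contraction assms mult_left_mono norm_blinfun norm_ge_zero order_trans)

text \<open>
  On \<open>D\<close> the dissipated energy bounds the output energy. For a general \<open>x\<close> the triangle
  inequality and the contraction property transfer this bound from approximations in \<open>D\<close>.
\<close>

lemma output_zero_if_norm_preserved:
  assumes iso: "norm (S \<tau> 0 x) = norm x" and t: "t \<in> {0..\<tau>}"
  shows "C (S t 0 x) = 0"
proof -
  define g where "g x t = (norm (C (S t 0 x)))\<^sup>2" for x t
  have g_cont: "continuous_on {0..\<tau>} (g x)" for x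
    unfolding g_def by (intro continuous_intros continuous_on_S)
  note g_int = integrable_continuous_real[OF g_cont]
  obtain X where X: "\<And>n. X n \<in> D" "X \<longlonglongrightarrow> x"
    using dense closure_sequential[of x D] by auto
  \<comment> \<open>Dissipation of \<open>X n\<close>, plus the error of replacing \<open>x\<close> by \<open>X n\<close>; both vanish in the limit.\<close>
  define B where "B n = ((norm (X n))\<^sup>2 - (norm (S \<tau> 0 (X n)))\<^sup>2) / (r - \<mu>)
      + 2 * (norm C * norm (x - X n))\<^sup>2 * \<tau>" for n
  have "integral {0..\<tau>} (g x) \<le> B n" for n
  proof -
    have "integral {0..\<tau>} (g x)
        \<le> integral {0..\<tau>} (\<lambda>t. 2 * g (X n) t + 2 * (norm C * norm (x - X n))\<^sup>2)"
    proof (rule integral_le[OF g_int])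
      show "(\<lambda>t. 2 * g (X n) t + 2 * (norm C * norm (x - X n))\<^sup>2) integrable_on {0..\<tau>}"
        by (intro integrable_continuous_real continuous_intros g_cont)
      fix t
      assume "t \<in> {0..\<tau>}"
      define a where "a = norm (C (S t 0 (X n)))"
      define b where "b = norm (C (S t 0 (x - X n)))"
      have "norm (C (S t 0 x)) \<le> a + b"
        using norm_triangle_ineq[of "C (S t 0 (X n))" "C (S t 0 (x - X n))"]
        by (simp add: a_def b_def blinfun.diff_right)
      then have "g x t \<le> (a + b)\<^sup>2"
        unfolding g_def by (intro power_mono) auto
      also have "\<dots> \<le> 2 * a\<^sup>2 + 2 * b\<^sup>2"
        using zero_le_power2[of "a - b"] by (simp add: power2_eq_square algebra_simps)
      also have "b\<^sup>2 \<le> (norm C * norm (x - X n))\<^sup>2"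
        unfolding b_def using norm_C_S_le \<open>t \<in> {0..\<tau>}\<close> by (intro power_mono) auto
      finally show "g x t \<le> 2 * g (X n) t + 2 * (norm C * norm (x - X n))\<^sup>2"
        by (simp add: a_def g_def)
    qed
    also have "\<dots> = 2 * integral {0..\<tau>} (g (X n)) + 2 * (norm C * norm (x - X n))\<^sup>2 * \<tau>"
      using period g_int[of "X n"]
      by (subst Henstock_Kurzweil_Integration.integral_add) (auto intro: integrable_on_mult_right)
    also have "\<dots> \<le> B n"
      using energy_balance_on_D[OF X(1)[of n]] gain
      by (simp add: B_def g_def[abs_def] field_simps)
    finally show ?thesis .
  qed
  moreover have "B \<longlonglongrightarrow> ((norm x)\<^sup>2 - (norm (S \<tau> 0 x))\<^sup>2) / (r - \<mu>)
      + 2 * (norm C * norm (x - x))\<^sup>2 * \<tau>"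
    unfolding B_def using gain by (intro tendsto_intros X) simp
  ultimately have "integral {0..\<tau>} (g x) \<le> 0"
    using iso LIMSEQ_le_const[of B 0] by simp
  moreover have "0 \<le> integral {0..\<tau>} (g x)"
    by (intro integral_nonneg g_int) (simp add: g_def)
  ultimately have "integral {0..\<tau>} (g x) = 0"
    by simp
  then have "g x t = 0"
    using integral_eq_0_iff[OF g_cont period, of x] t by (auto simp: g_def)
  then show ?thesis
    by (simp add: g_def)
qed

text \<open>
  The difference \<open>v\<close> of the two trajectories satisfies \<open>v' = A v - r C\<^sup>* C S(t,0) x\<close> when they start
  in \<open>D\<close>, where weak detectability bounds \<open>\<langle>A v, v\<rangle>\<close>; so \<open>v\<close> is controlled by the output along \<open>S\<close>.
  Approximations of \<open>x\<close> in \<open>D\<close> have small outputs.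
\<close>

lemma free_evolution_if_output_zero:
  assumes out: "\<And>t. t \<in> {0..\<tau>} \<Longrightarrow> C (S t 0 x) = 0" and s: "s \<in> {0..\<tau>}"
  shows "S s 0 x = T s 0 x"
proof -
  obtain X where X: "\<And>n. X n \<in> D" "X \<longlonglongrightarrow> x"
    using dense closure_sequential[of x D] by auto
  \<comment> \<open>These constants result from \<open>2 a b \<le> a\<^sup>2 + b\<^sup>2\<close>, applied to the two outputs in the cross term.\<close>
  define k where "k = (2 * \<mu> + r) * (norm C)\<^sup>2"
  define c where "c n = r * (norm C * norm (X n - x))\<^sup>2" for n
  have "(norm (S s 0 (X n) - T s 0 (X n)))\<^sup>2 \<le> c n * s * exp (k * s)" for n
  proof -
    define v where "v t = S t 0 (X n) - T t 0 (X n)" for t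
    define v' where "v' t = observer_family A C r t (S t 0 (X n)) - A t (T t 0 (X n))" for t
    have "(norm (v s))\<^sup>2 \<le> ((norm (v 0))\<^sup>2 + c n * s) * exp (k * s)"
    proof (rule norm_sq_gronwall)
      fix t :: real
      assume t: "0 \<le> t"
      show "(v has_vector_derivative v' t) (at t within {0..})"
        unfolding v_def v'_def using S_deriv T_deriv X(1) t
        by (intro has_vector_derivative_diff) auto
    next
      fix t :: real
      assume t: "0 \<le> t" "t \<le> s"
      have D1: "S t 0 (X n) \<in> D" and D2: "T t 0 (X n) \<in> D"
        using S_in_D T_in_D X(1) t by auto
      define a where "a = norm (C (S t 0 (X n)))"
      define b where "b = norm (C (v t))"
      have "v' t \<bullet> v t = A t (v t) \<bullet> v t + - (r * (C (S t 0 (X n)) \<bullet> C (v t)))"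
        using A_diff[OF t(1) D1 D2]
        by (simp add: v'_def inner_diff_left inner_observer_family v_def)
      also have "\<dots> \<le> \<mu> * b\<^sup>2 + r * (a * b)"
      proof (rule add_mono)
        show "A t (v t) \<bullet> v t \<le> \<mu> * b\<^sup>2"
          using detectable t D_diff[OF D1 D2] by (simp add: weakly_detectable_def b_def v_def)
        show "- (r * (C (S t 0 (X n)) \<bullet> C (v t))) \<le> r * (a * b)"
        proof -
          have "- (C (S t 0 (X n)) \<bullet> C (v t)) \<le> a * b"
            using Cauchy_Schwarz_ineq2[of "C (S t 0 (X n))" "C (v t)"] by (simp add: a_def b_def)
          then have "r * (- (C (S t 0 (X n)) \<bullet> C (v t))) \<le> r * (a * b)"
            using gain mu by (intro mult_left_mono) auto
          then show ?thesis
            by simp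
        qed
      qed
      finally have "2 * (v' t \<bullet> v t) \<le> 2 * \<mu> * b\<^sup>2 + r * (2 * a * b)"
        by simp
      also have "r * (2 * a * b) \<le> r * (a\<^sup>2 + b\<^sup>2)"
        using sum_squares_bound[of a b] gain mu by (intro mult_left_mono) auto
      finally have "2 * (v' t \<bullet> v t) \<le> (2 * \<mu> + r) * b\<^sup>2 + r * a\<^sup>2"
        by (simp add: algebra_simps)
      also have "b\<^sup>2 \<le> (norm C)\<^sup>2 * (norm (v t))\<^sup>2"
        unfolding b_def power_mult_distrib[symmetric] by (intro power_mono norm_blinfun) simp
      also have "a\<^sup>2 \<le> (norm C * norm (X n - x))\<^sup>2"
      proof -
        have "C (S t 0 (X n)) = C (S t 0 (X n - x))"
          using out[of t] t s by (simp add: blinfun.diff_right)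
        then show ?thesis
          unfolding a_def using norm_C_S_le[OF t(1), of "X n - x"] by (intro power_mono) auto
      qed
      finally show "2 * (v' t \<bullet> v t) \<le> k * (norm (v t))\<^sup>2 + c n"
        using gain mu by (simp add: k_def c_def mult.assoc)
    qed (use gain mu s in \<open>auto simp: k_def c_def\<close>)
    then show ?thesis
      by (simp add: v_def S_id T_id)
  qed
  moreover have "(\<lambda>n. (norm (S s 0 (X n) - T s 0 (X n)))\<^sup>2) \<longlonglongrightarrow> (norm (S s 0 x - T s 0 x))\<^sup>2"
    by (intro tendsto_intros X)
  moreover have "(\<lambda>n. c n * s * exp (k * s))
      \<longlonglongrightarrow> r * (norm C * norm (x - x))\<^sup>2 * s * exp (k * s)"
    unfolding c_def by (intro tendsto_intros X)
  ultimately have "(norm (S s 0 x - T s 0 x))\<^sup>2 \<le> r * (norm C * norm (x - x))\<^sup>2 * s * exp (k * s)"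
    by (meson LIMSEQ_le)
  then show ?thesis
    by simp
qed

lemma gramian_zero_if_norm_preserved:
  assumes "norm (S \<tau> 0 x) = norm x"
  shows "observability_gramian T C \<tau> x = 0"
proof -
  have "C (T t 0 x) = 0" if "t \<in> {0..\<tau>}" for t
    using output_zero_if_norm_preserved[OF assms] free_evolution_if_output_zero[of x t] that by metis
  then have "integral {0..\<tau>}
      (\<lambda>t. adjoint (blinfun_apply (T t 0)) (adjoint (blinfun_apply C) (C (T t 0 x))))
      = integral {0..\<tau>} (\<lambda>t. 0)"
    by (intro integral_cong) (simp add: adjoint_blinfun_zero)
  then show ?thesis
    by (simp add: observability_gramian_def)
qed

section \<open>Convergence of the observer\<close>

lemma error_splitting:
  obtains p where "((\<lambda>t. S t 0 (x - p)) \<longlongrightarrow> 0) at_top"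
    and "\<And>n. norm (S \<tau> 0 ((blinfun_apply (S \<tau> 0) ^^ n) p)) = norm ((blinfun_apply (S \<tau> 0) ^^ n) p)"
proof -
  have "norm (S \<tau> 0 y) \<le> norm y" for y
    using S_contraction period by simp
  from normal_contraction_splitting[OF normal this, of x] show thesis
    by (auto intro: that S_tendsto_0_if_powers_tendsto_0)
qed

lemma observer_converges:
  assumes "observable_subspace T C \<tau> = UNIV"
  shows "strong_asymptotic_observer S"
  unfolding strong_asymptotic_observer_def
proof
  fix x
  obtain p where lim: "((\<lambda>t. S t 0 (x - p)) \<longlongrightarrow> 0) at_top"
    and iso: "\<And>n. norm (S \<tau> 0 ((blinfun_apply (S \<tau> 0) ^^ n) p)) = norm ((blinfun_apply (S \<tau> 0) ^^ n) p)"
    by (rule error_splitting[of x]) blast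
  have "observability_gramian T C \<tau> p = 0"
    using gramian_zero_if_norm_preserved iso[of 0] by simp
  moreover have "p \<in> observable_subspace T C \<tau>"
    by (simp add: assms)
  ultimately have "p = 0"
    by (auto simp: observable_subspace_def orthogonal_comp_def orthogonal_def)
  then show "((\<lambda>t. S t 0 x) \<longlongrightarrow> 0) at_top"
    using lim by simp
qed

text \<open>
  The isometric part \<open>p\<close> of the initial error stays unobservable after each period, where
  \<open>S\<close> and \<open>T\<close> agree; so invariance of the complement of the observable subspace under \<open>T\<close>
  keeps its trajectory invisible to the projection.
\<close>

lemma observer_converges_on_observable_subspace:
  defines "V \<equiv> observable_subspace T C \<tau>"
  assumes inv: "\<And>t. t \<in> {0..\<tau>} \<Longrightarrow> blinfun_apply (T t 0) ` (V\<^sup>\<bottom>) \<subseteq> V\<^sup>\<bottom>"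
  shows "strong_asymptotic_observer_on V S"
  unfolding strong_asymptotic_observer_on_def
proof
  fix x
  obtain p where lim: "((\<lambda>t. S t 0 (x - p)) \<longlongrightarrow> 0) at_top"
    and iso: "\<And>n. norm (S \<tau> 0 ((blinfun_apply (S \<tau> 0) ^^ n) p)) = norm ((blinfun_apply (S \<tau> 0) ^^ n) p)"
    by (rule error_splitting[of x]) blast
  have V: "subspace V" "closed V"
    by (simp_all add: V_def observable_subspace_def subspace_orthogonal_comp closed_orthogonal_comp)
  have hidden: "S t 0 p \<in> V\<^sup>\<bottom>" if t: "0 \<le> t" for t
  proof -
    define n where "n = nat \<lfloor>t / \<tau>\<rfloor>"
    define s where "s = t - real n * \<tau>"
    define q where "q = (blinfun_apply (S \<tau> 0) ^^ n) p"
    have "real n \<le> t / \<tau>" "t / \<tau> \<le> real n + 1"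
      using t period by (auto simp: n_def)
    then have s: "s \<in> {0..\<tau>}"
      using period by (simp add: s_def field_simps)
    have "S t 0 p = S s 0 q"
      using S_iterate[of s n p] s by (simp add: s_def q_def)
    also have "\<dots> = T s 0 q"
      using free_evolution_if_output_zero[OF _ s] output_zero_if_norm_preserved iso
      by (metis q_def)
    also have "q \<in> V\<^sup>\<bottom>"
      using gramian_zero_if_norm_preserved[OF iso] orthogonal_comp_subset
      unfolding V_def observable_subspace_def q_def by fast
    then have "T s 0 q \<in> V\<^sup>\<bottom>"
      using inv[OF s] by blast
    finally show ?thesis .
  qed
  have "norm (orth_proj V (S t 0 x)) \<le> norm (S t 0 (x - p))" if "0 \<le> t" for t
    using norm_orth_proj_add_le[OF V hidden[OF that], of "S t 0 (x - p)"]
    by (simp add: blinfun.diff_right)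
  then have "\<forall>\<^sub>F t in at_top. norm (orth_proj V (S t 0 x)) \<le> norm (S t 0 (x - p))"
    unfolding eventually_at_top_linorder by blast
  then show "((\<lambda>t. orth_proj V (S t 0 x)) \<longlongrightarrow> 0) at_top"
    by (rule Lim_null_comparison) (rule tendsto_norm_zero[OF lim])
qed

end

text \<open>A generator is a pointwise limit of the linear maps \<open>(G h - 1)/h\<close>.\<close>

lemma generator_diff:
  assumes gen: "generates_C0_semigroup D A" and "x \<in> D" "y \<in> D" "x - y \<in> D"
  shows "A (x - y) = A x - A y"
proof -
  from gen obtain G :: "real \<Rightarrow> 'a \<Rightarrow>\<^sub>L 'a"
    where G: "\<And>x. x \<in> D \<Longrightarrow> ((\<lambda>h. (G h x - x) /\<^sub>R h) \<longlongrightarrow> A x) (at_right 0)"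
    unfolding generates_C0_semigroup_def by blast
  have "((\<lambda>h. (G h x - x) /\<^sub>R h - (G h y - y) /\<^sub>R h) \<longlongrightarrow> A x - A y) (at_right 0)"
    by (intro tendsto_diff G assms)
  moreover have "(\<lambda>h. (G h x - x) /\<^sub>R h - (G h y - y) /\<^sub>R h)
      = (\<lambda>h. (G h (x - y) - (x - y)) /\<^sub>R h)"
    by (simp add: blinfun.diff_right algebra_simps)
  ultimately show ?thesis
    using G[OF \<open>x - y \<in> D\<close>] tendsto_unique[of "at_right (0::real)"] by auto
qed

text \<open>Density of \<open>D\<close> makes the value of the adjoint unique, which identifies it as \<open>- A x\<close>.\<close>

lemma skew_adjoint_inner_self:
  assumes dense: "closure D = UNIV" and skew: "skew_adjoint D A" and x: "x \<in> D"
  shows "A x \<bullet> x = 0"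
proof -
  have "x \<in> adjoint_domain D A"
    using skew x by (simp add: skew_adjoint_def)
  then obtain z where z: "\<forall>w\<in>D. A w \<bullet> x = w \<bullet> z"
    by (auto simp: adjoint_domain_def)
  have "adjoint_on D A x = z"
    unfolding adjoint_on_def
  proof (rule the_equality)
    show "\<forall>w\<in>D. A w \<bullet> x = w \<bullet> z"
      by (rule z)
  next
    fix z'
    assume z': "\<forall>w\<in>D. A w \<bullet> x = w \<bullet> z'"
    have "closure D \<subseteq> {w. (z' - z) \<bullet> w = 0}"
    proof (rule closure_minimal)
      show "D \<subseteq> {w. (z' - z) \<bullet> w = 0}"
        using z z' by (auto simp: inner_diff_right inner_commute[of "z' - z"])
    qed (rule closed_hyperplane)
    then have "z' - z \<in> {w. (z' - z) \<bullet> w = 0}"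
      using dense by blast
    then show "z' = z"
      by simp
  qed
  then have "z = - A x"
    using skew x by (simp add: skew_adjoint_def)
  then have "A x \<bullet> x = - (A x \<bullet> x)"
    using bspec[OF z x] by (metis inner_commute inner_minus_right)
  then show ?thesis
    by simp
qed

theorem theorem3p8:
  fixes D :: "'x::{real_inner,complete_space} set"
    and A :: "real \<Rightarrow> 'x \<Rightarrow> 'x"
    and C :: "'x \<Rightarrow>\<^sub>L 'y::{real_inner,complete_space}"
    and T S :: "real \<Rightarrow> real \<Rightarrow> 'x \<Rightarrow>\<^sub>L 'x"
    and r \<tau> :: real
  assumes "standing_assumptions D A"
    and "generates_evolution_system D A T"
    and "r > 0"
    and "generates_evolution_system D (observer_family A C r) S"
    and "\<tau> > 0"
    and "\<And>t x. t \<ge> 0 \<Longrightarrow> x \<in> D \<Longrightarrow> A (t + \<tau>) x = A t x"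
  shows "(\<forall>\<mu>\<ge>0. weakly_detectable D A C \<mu> \<and> r > \<mu> \<and>
            normal_operator (S \<tau> 0) \<and> bounded_from_below (S \<tau> 0) \<and>
            observable_subspace T C \<tau> = UNIV
          \<longrightarrow> strong_asymptotic_observer S)
       \<and> ((\<forall>t\<ge>0. skew_adjoint D (A t)) \<and> normal_operator (S \<tau> 0) \<and>
            (\<forall>t\<in>{0..\<tau>}.
               blinfun_apply (T t 0) ` observable_subspace T C \<tau> \<subseteq> observable_subspace T C \<tau> \<and>
               blinfun_apply (T t 0) ` ((observable_subspace T C \<tau>)\<^sup>\<bottom>)
                 \<subseteq> (observable_subspace T C \<tau>)\<^sup>\<bottom>)
          \<longrightarrow> strong_asymptotic_observer_on (observable_subspace T C \<tau>) S)"
proof -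
  have dense: "closure D = UNIV" and D: "subspace D"
    and gen: "\<And>t. 0 \<le> t \<Longrightarrow> generates_C0_semigroup D (A t)"
    using assms(1) by (auto simp: standing_assumptions_def)
  have error: "observer_error D A C T S r \<mu> \<tau>"
    if "weakly_detectable D A C \<mu>" "0 \<le> \<mu>" "\<mu> < r" "normal_operator (S \<tau> 0)" for \<mu>
    using that assms dense D
    by unfold_locales (auto intro: subspace_diff generator_diff[OF gen])
  show ?thesis
  proof (intro conjI allI impI)
    fix \<mu> :: real
    assume "0 \<le> \<mu>" and "weakly_detectable D A C \<mu> \<and> r > \<mu> \<and> normal_operator (S \<tau> 0)
      \<and> bounded_from_below (S \<tau> 0) \<and> observable_subspace T C \<tau> = UNIV"
    then show "strong_asymptotic_observer S"
      using observer_error.observer_converges[OF error] by blast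
  next
    assume hyp: "(\<forall>t\<ge>0. skew_adjoint D (A t)) \<and> normal_operator (S \<tau> 0) \<and>
      (\<forall>t\<in>{0..\<tau>}.
         blinfun_apply (T t 0) ` observable_subspace T C \<tau> \<subseteq> observable_subspace T C \<tau> \<and>
         blinfun_apply (T t 0) ` ((observable_subspace T C \<tau>)\<^sup>\<bottom>)
           \<subseteq> (observable_subspace T C \<tau>)\<^sup>\<bottom>)"
    then have "weakly_detectable D A C 0"
      using skew_adjoint_inner_self[OF dense] by (simp add: weakly_detectable_def)
    then show "strong_asymptotic_observer_on (observable_subspace T C \<tau>) S"
      using observer_error.observer_converges_on_observable_subspace[OF error[of 0]] hyp assms(3)
      by blast
  qed
qed

end
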